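(* Let $B$ be a left semi-brace such that $E$ is an ideal of $B$. Then $B$ admits a $z$-series if and only if there exists a positive integer $n$ such that $B=\operatorname{Zoc}_n(B)$.
   Context: A left semi-brace is a set $B$ with two operations $+$ and $\circ$ such that $(B,+)$ is a left cancellative semigroup (not necessarily commutative), $(B,\circ)$ is a group, and $a\circ(b+c)=a\circ b+a\circ(a^-+c)$ for all $a,b,c\in B$, where $a^-$ is the inverse of $a$ in $(B,\circ)$ and $\circ$ has higher precedence than $+$. The identity of $(B,\circ)$ is denoted $0$; it is an idempotent and a left identity of $(B,+)$. Let $E$ be the set of idempotents of $(B,+)$ and $G=B+0=\{b+0: b\in B\}$, which is a subgroup of $(B,+)$ (with identity $0$). For $a,b\in B$ put $\lambda_a(b)=a\circ(a^-+b)$ and $\rho_b(a)=(a^-+b)^-\circ b$. A subsemigroup $I$ of $(B,+)$ is an ideal of $B$ if: (i) $I$ is a normal subgroup of $(B,\circ)$; (ii) $I\cap G$ is a normal subgroup of $(G,+)$; (iii) $\rho_b(n)\in I$ for all $b\in B$, $n\in I\cap G$; (iv) $\lambda_g(e)\in I$ for all $g\in G$, $e\in I\cap E$. For an ideal $I$, $B/I$ is the quotient group $(B,\circ)/I$ with the induced addition (which is well defined); it is a left semi-brace. The socle of a left semi-brace $B$ is $\operatorname{Soc}(B)=\{a\in B:\rho_a=\rho_0,\ \lambda_a=\lambda_0\}$, an ideal of $B$ contained in $G$. When $E$ is an ideal of $B$, the generalized socle is $\operatorname{Zoc}(B)=\operatorname{Soc}(B)+E=\{a+e:a\in\operatorname{Soc}(B),e\in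 E\}$, an ideal of $B$. The generalized socle series of such a $B$ is defined by $\operatorname{Zoc}_0(B)=E$, $\operatorname{Zoc}_1(B)=\operatorname{Zoc}(B)$ and, for $k>1$, $\operatorname{Zoc}_k(B)$ is the ideal of $B$ containing $\operatorname{Zoc}_{k-1}(B)$ such that $\operatorname{Zoc}_k(B)/\operatorname{Zoc}_{k-1}(B)=\operatorname{Zoc}(B/\operatorname{Zoc}_{k-1}(B))=\operatorname{Soc}(B/\operatorname{Zoc}_{k-1}(B))$. A $z$-series of $B$ is a finite sequence $B=I_0\supseteq I_1\supseteq\cdots\supseteq I_n=E$ of ideals of $B$ such that $I_{j-1}/I_j\subseteq\operatorname{Soc}(B/I_j)$ for every $j\in\{1,\dots,n\}$. *)

theory Defs
  imports "HOL-Algebra.Coset"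
begin

(* The underlying monoid record carries the circle operation (written multiplicatively, with
   identity \<one>, which plays the role of 0); the extra field is the semigroup addition. *)
record 'a semi_brace = "'a monoid" +
  sadd :: "'a \<Rightarrow> 'a \<Rightarrow> 'a"  (infixl \<open>\<boxplus>\<index>\<close> 65)

locale left_semi_brace = group B for B (structure) +
  assumes sadd_closed [intro, simp]:
      "\<lbrakk>a \<in> carrier B; b \<in> carrier B\<rbrakk> \<Longrightarrow> a \<boxplus> b \<in> carrier B"
    and sadd_assoc:
      "\<lbrakk>a \<in> carrier B; b \<in> carrier B; c \<in> carrier B\<rbrakk> \<Longrightarrow> (a \<boxplus> b) \<boxplus> c = a \<boxplus> (b \<boxplus> c)"
    and sadd_left_cancel:
      "\<lbrakk>a \<in> carrier B; b \<in> carrier B; c \<in> carrier B; a \<boxplus> b = a \<boxplus> c\<rbrakk> \<Longrightarrow> b = c"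
    and mult_sadd:
      "\<lbrakk>a \<in> carrier B; b \<in> carrier B; c \<in> carrier B\<rbrakk>
         \<Longrightarrow> a \<otimes> (b \<boxplus> c) = (a \<otimes> b) \<boxplus> (a \<otimes> (inv a \<boxplus> c))"

definition idempotents :: "('a, 'm) semi_brace_scheme \<Rightarrow> 'a set"
  where "idempotents B = {e \<in> carrier B. e \<boxplus>\<^bsub>B\<^esub> e = e}"

definition add_part :: "('a, 'm) semi_brace_scheme \<Rightarrow> 'a set"
  where "add_part B = (\<lambda>b. b \<boxplus>\<^bsub>B\<^esub> \<one>\<^bsub>B\<^esub>) ` carrier B"

(* The group (G, +), where G = B + 0. *)
definition add_group :: "('a, 'm) semi_brace_scheme \<Rightarrow> 'a monoid"
  where "add_group B = \<lparr>carrier = add_part B, monoid.mult = sadd B, one = \<one>\<^bsub>B\<^esub>\<rparr>"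

definition lam :: "('a, 'm) semi_brace_scheme \<Rightarrow> 'a \<Rightarrow> 'a \<Rightarrow> 'a"
  where "lam B a b = a \<otimes>\<^bsub>B\<^esub> (inv\<^bsub>B\<^esub> a \<boxplus>\<^bsub>B\<^esub> b)"

(* The index comes first: rho B b a is \<rho>_b(a). *)
definition rho :: "('a, 'm) semi_brace_scheme \<Rightarrow> 'a \<Rightarrow> 'a \<Rightarrow> 'a"
  where "rho B b a = inv\<^bsub>B\<^esub> (inv\<^bsub>B\<^esub> a \<boxplus>\<^bsub>B\<^esub> b) \<otimes>\<^bsub>B\<^esub> b"

definition sb_ideal :: "'a set \<Rightarrow> ('a, 'm) semi_brace_scheme \<Rightarrow> bool"
  where "sb_ideal I B \<longleftrightarrow>
    (\<forall>a\<in>I. \<forall>b\<in>I. a \<boxplus>\<^bsub>B\<^esub> b \<in> I) \<and>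
    I \<lhd> B \<and>
    (I \<inter> add_part B) \<lhd> add_group B \<and>
    (\<forall>b\<in>carrier B. \<forall>n\<in>I \<inter> add_part B. rho B b n \<in> I) \<and>
    (\<forall>g\<in>add_part B. \<forall>e\<in>I \<inter> idempotents B. lam B g e \<in> I)"

(* The sum of two cosets X and Y is the coset of a + b for any representatives a of X and b of Y;
   when I is an ideal all the cosets in the union coincide. *)
definition sb_quotient :: "('a, 'm) semi_brace_scheme \<Rightarrow> 'a set \<Rightarrow> 'a set semi_brace"
  where "sb_quotient B I =
    \<lparr>carrier = carrier (B Mod I), monoid.mult = monoid.mult (B Mod I), one = \<one>\<^bsub>B Mod I\<^esub>,
     sadd = (\<lambda>X Y. \<Union>a\<in>X. \<Union>b\<in>Y. I #>\<^bsub>B\<^esub> (a \<boxplus>\<^bsub>B\<^esub> b))\<rparr>"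

(* The subset J/I of B/I. *)
definition quot_set :: "('a, 'm) semi_brace_scheme \<Rightarrow> 'a set \<Rightarrow> 'a set \<Rightarrow> 'a set set"
  where "quot_set B J I = (\<lambda>a. I #>\<^bsub>B\<^esub> a) ` J"

(* \<rho>_a and \<lambda>_a are maps on B, so they are compared on the carrier only. *)
definition Soc :: "('a, 'm) semi_brace_scheme \<Rightarrow> 'a set"
  where "Soc B = {a \<in> carrier B.
    (\<forall>b\<in>carrier B. rho B a b = rho B \<one>\<^bsub>B\<^esub> b) \<and>
    (\<forall>b\<in>carrier B. lam B a b = lam B \<one>\<^bsub>B\<^esub> b)}"

definition Zoc :: "('a, 'm) semi_brace_scheme \<Rightarrow> 'a set"
  where "Zoc B = {a \<boxplus>\<^bsub>B\<^esub> e | a e. a \<in> Soc B \<and> e \<in> idempotents B}"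

(* Zoc_1(B) is Zoc(B) itself and in general differs from the preimage of Zoc(B/E),
   so the quotient description only starts at index 2. *)
fun Zoc_series :: "('a, 'm) semi_brace_scheme \<Rightarrow> nat \<Rightarrow> 'a set" where
  "Zoc_series B 0 = idempotents B"
| "Zoc_series B (Suc 0) = Zoc B"
| "Zoc_series B (Suc (Suc k)) =
    (THE J. sb_ideal J B \<and> Zoc_series B (Suc k) \<subseteq> J \<and>
       quot_set B J (Zoc_series B (Suc k)) = Zoc (sb_quotient B (Zoc_series B (Suc k))))"

(* The description determines at most one ideal: J is the preimage of J/I. *)
lemma (in left_semi_brace) quot_set_inject:
  assumes "sb_ideal I B" "sb_ideal J B" "sb_ideal K B" "I \<subseteq> J" "I \<subseteq> K"
    and "quot_set B J I = quot_set B K I"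
  shows "J = K"
proof -
  have sub: "J \<subseteq> K" if J: "sb_ideal J B" and K: "sb_ideal K B" and IK: "I \<subseteq> K"
    and eq: "quot_set B J I = quot_set B K I" for J K
  proof
    fix a assume a: "a \<in> J"
    interpret I: normal I B using assms(1) by (simp add: sb_ideal_def)
    interpret J: normal J B using J by (simp add: sb_ideal_def)
    interpret K: normal K B using K by (simp add: sb_ideal_def)
    have "I #> a \<in> quot_set B K I"
      using a eq[symmetric] by (simp add: quot_set_def)
    then obtain k where k: "k \<in> K" "I #> a = I #> k"
      by (auto simp: quot_set_def)
    have "a \<in> I #> a"
      using a J.mem_carrier I.subgroup_axioms rcos_self by blast
    then obtain i where "i \<in> I" "a = i \<otimes> k"
      using k by (auto simp: r_coset_def)
    then show "a \<in> K" using k IK by auto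
  qed
  show ?thesis using sub assms by (metis subset_antisym)
qed

definition z_series :: "('a, 'm) semi_brace_scheme \<Rightarrow> (nat \<Rightarrow> 'a set) \<Rightarrow> nat \<Rightarrow> bool"
  where "z_series B I n \<longleftrightarrow>
    (\<forall>j\<le>n. sb_ideal (I j) B) \<and>
    I 0 = carrier B \<and> I n = idempotents B \<and>
    (\<forall>j\<in>{1..n}. I j \<subseteq> I (j - 1) \<and>
       quot_set B (I (j - 1)) (I j) \<subseteq> Soc (sb_quotient B (I j)))"

end

theory Submission
  imports Defs
begin

text \<open>
  Write \<open>0\<close> for the identity, \<open>E\<close> for the set of idempotents and \<open>G = B + 0\<close>.

  Multiplication is \<open>a \<circ> b = a + \<lambda>\<^sub>a(b)\<close>, where \<open>\<lambda>\<close> is an action of \<open>(B, \<circ>)\<close> by automorphisms of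
  \<open>(B, +)\<close>. Consequently \<open>(B, +)\<close> is a right group: each element is the sum of an element of \<open>G\<close> and
  an idempotent, and each idempotent is a left identity. Every ideal in question contains \<open>E\<close>, and
  such an ideal \<open>I\<close> is just a normal subgroup of \<open>(B, \<circ>)\<close> that is closed under addition and
  under all \<open>\<lambda>\<^sub>b\<close> and is additively normal (lemma \<open>sb_ideal_iff\<close>). Its cosets are the sets
  \<open>a + I\<close>; therefore \<open>B/I\<close> is a left semi-brace, it has no idempotent besides its identity, so
  that \<open>Zoc (B/I) = Soc (B/I)\<close>, and preimages of ideals of \<open>B/I\<close> are ideals of \<open>B\<close>.

  An element \<open>a\<close> lies in the socle iff \<open>a \<circ> x = a + x\<close> and \<open>a + x + 0 = x + a\<close> for all \<open>x\<close>
  (lemma \<open>Soc_iff\<close>). These equations show that \<open>Soc(B) + E\<close> is an ideal whenever \<open>E\<close> is normal in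
  \<open>(B, \<circ>)\<close> (lemma \<open>sb_ideal_Zoc\<close>). Hence every term of the generalized socle series exists and is an
  ideal, and for \<open>k \<ge> 1\<close> the term \<open>Zoc\<^sub>k\<^sub>+\<^sub>1(B)\<close> is the preimage of \<open>Soc (B/Zoc\<^sub>k(B))\<close>.

  If \<open>B = Zoc\<^sub>n(B)\<close>, the generalized socle series read downwards from \<open>n\<close> is a \<open>z\<close>-series. Conversely,
  the preimage of \<open>Soc (B/I)\<close> is described by congruences modulo \<open>I\<close>, so it increases with \<open>I\<close>, and
  induction gives \<open>I\<^sub>n\<^sub>-\<^sub>j \<subseteq> Zoc\<^sub>j\<^sub>+\<^sub>1(B)\<close> for every \<open>z\<close>-series \<open>I\<close>; \<open>j = n\<close> yields
  \<open>B = Zoc\<^sub>n\<^sub>+\<^sub>1(B)\<close>. The index is shifted by one because \<open>I\<^sub>n\<^sub>-\<^sub>1\<close> is only known to be contained in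
  the preimage of \<open>Soc (B/E)\<close>, which can be larger than \<open>Zoc\<^sub>1(B)\<close>.
\<close>

section \<open>The additive semigroup and the maps \<open>\<lambda>\<^sub>a\<close>\<close>

context left_semi_brace
begin

lemma one_sadd [simp]: "b \<in> carrier B \<Longrightarrow> \<one> \<boxplus> b = b"
  using mult_sadd[of \<one> \<one> b] sadd_left_cancel[of \<one> b "\<one> \<boxplus> b"] by simp

lemma lam_closed [simp]: "\<lbrakk>a \<in> carrier B; b \<in> carrier B\<rbrakk> \<Longrightarrow> lam B a b \<in> carrier B"
  by (simp add: lam_def)

lemma mult_sadd_lam:
  "\<lbrakk>a \<in> carrier B; b \<in> carrier B; c \<in> carrier B\<rbrakk> \<Longrightarrow> a \<otimes> (b \<boxplus> c) = a \<otimes> b \<boxplus> lam B a c"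
  unfolding lam_def by (rule mult_sadd)

lemma mult_eq_sadd_lam:
  "\<lbrakk>a \<in> carrier B; b \<in> carrier B\<rbrakk> \<Longrightarrow> a \<otimes> b = a \<boxplus> lam B a b"
  using mult_sadd_lam[of a \<one> b] by simp

lemma lam_one_left [simp]: "b \<in> carrier B \<Longrightarrow> lam B \<one> b = b"
  by (simp add: lam_def)

lemma lam_sadd:
  assumes "a \<in> carrier B" "b \<in> carrier B" "c \<in> carrier B"
  shows "lam B a (b \<boxplus> c) = lam B a b \<boxplus> lam B a c"
proof -
  have "lam B a (b \<boxplus> c) = a \<otimes> ((inv a \<boxplus> b) \<boxplus> c)"
    using assms by (simp add: lam_def sadd_assoc)
  also have "\<dots> = lam B a b \<boxplus> lam B a c"
    using assms by (subst mult_sadd_lam) (simp_all add: lam_def)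
  finally show ?thesis .
qed

lemma lam_mult:
  assumes "a \<in> carrier B" "b \<in> carrier B" "c \<in> carrier B"
  shows "lam B (a \<otimes> b) c = lam B a (lam B b c)"
proof (rule sadd_left_cancel[of "a \<otimes> b"])
  have "a \<otimes> b \<boxplus> lam B (a \<otimes> b) c = a \<otimes> (b \<otimes> c)"
    using assms by (simp add: mult_eq_sadd_lam[symmetric] m_assoc)
  also have "\<dots> = a \<otimes> (b \<boxplus> lam B b c)"
    using assms by (simp add: mult_eq_sadd_lam[of b c])
  also have "\<dots> = a \<otimes> b \<boxplus> lam B a (lam B b c)"
    using assms by (simp add: mult_sadd_lam)
  finally show "a \<otimes> b \<boxplus> lam B (a \<otimes> b) c = a \<otimes> b \<boxplus> lam B a (lam B b c)" .
qed (use assms in auto)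

lemma lam_lam_inv [simp]:
  "\<lbrakk>a \<in> carrier B; b \<in> carrier B\<rbrakk> \<Longrightarrow> lam B a (lam B (inv a) b) = b"
  by (simp add: lam_mult[symmetric])

lemma sadd_eq_mult_lam:
  "\<lbrakk>a \<in> carrier B; b \<in> carrier B\<rbrakk> \<Longrightarrow> a \<boxplus> b = a \<otimes> lam B (inv a) b"
  by (simp add: mult_eq_sadd_lam)

lemma idempotents_sub: "idempotents B \<subseteq> carrier B"
  by (auto simp: idempotents_def)

lemma idempotent_sadd:
  assumes "e \<in> idempotents B" "x \<in> carrier B"
  shows "e \<boxplus> x = x"
proof (rule sadd_left_cancel[of e])
  show "e \<boxplus> (e \<boxplus> x) = e \<boxplus> x"
    using assms by (simp add: idempotents_def sadd_assoc[symmetric])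
qed (use assms in \<open>auto simp: idempotents_def\<close>)

lemma one_idempotent [simp]: "\<one> \<in> idempotents B"
  by (simp add: idempotents_def)

lemma lam_idempotent:
  "\<lbrakk>a \<in> carrier B; e \<in> idempotents B\<rbrakk> \<Longrightarrow> lam B a e \<in> idempotents B"
  using lam_sadd[of a e e] by (simp add: idempotents_def)

lemma add_part_iff: "a \<in> add_part B \<longleftrightarrow> a \<in> carrier B \<and> a \<boxplus> \<one> = a"
  unfolding add_part_def using sadd_assoc[of _ \<one> \<one>] by (metis (no_types, lifting) image_iff one_closed one_sadd sadd_closed)

text \<open>\<open>G\<close> is the stabilizer of \<open>0\<close> under \<open>\<lambda>\<close>; in particular it is closed under multiplicative
  inverses.\<close>

lemma lam_inv_one_iff:
  assumes "a \<in> carrier B"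
  shows "lam B (inv a) \<one> = \<one> \<longleftrightarrow> a \<in> add_part B"
proof -
  have "lam B (inv a) \<one> = inv a \<otimes> (a \<boxplus> \<one>)"
    using assms by (simp add: lam_def)
  also have "\<dots> = \<one> \<longleftrightarrow> a \<boxplus> \<one> = a"
    using assms inv_solve_left'[of \<one> a "a \<boxplus> \<one>"] by auto
  finally show ?thesis
    using assms by (simp add: add_part_iff)
qed

text \<open>The multiplicative inverse provides additive right inverses; hence \<open>(B, +)\<close> is a right
  group.\<close>

lemma right_inverse_ex:
  assumes "a \<in> carrier B"
  obtains c where "c \<in> carrier B" "a \<boxplus> c = \<one>"
  using assms that[of "lam B a (inv a)"] by (simp add: mult_eq_sadd_lam[symmetric])

lemma right_inverse_idempotent:
  assumes b: "b \<in> carrier B" and c: "c \<in> carrier B" and bc: "b \<boxplus> c = \<one>"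
  shows "c \<boxplus> b \<in> idempotents B"
proof -
  have "c \<boxplus> (b \<boxplus> (c \<boxplus> b)) = c \<boxplus> b"
    using b c bc by (simp add: sadd_assoc[symmetric, of b c b])
  then show ?thesis
    using b c by (simp add: idempotents_def sadd_assoc)
qed

lemma sadd_one_idempotent_ex:
  assumes b: "b \<in> carrier B"
  obtains e where "e \<in> idempotents B" "b = (b \<boxplus> \<one>) \<boxplus> e"
proof -
  obtain c where c: "c \<in> carrier B" "b \<boxplus> c = \<one>"
    using right_inverse_ex[OF b] .
  have "(b \<boxplus> \<one>) \<boxplus> (c \<boxplus> b) = b"
    using b c by (simp add: sadd_assoc) (simp add: sadd_assoc[symmetric])
  then show ?thesis
    using that[of "c \<boxplus> b"] right_inverse_idempotent[OF b c] by simp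
qed

lemma add_part_inverse:
  assumes g: "g \<in> add_part B" and c: "c \<in> carrier B" and gc: "g \<boxplus> c = \<one>"
  shows "c \<boxplus> \<one> \<in> add_part B" "g \<boxplus> (c \<boxplus> \<one>) = \<one>" "(c \<boxplus> \<one>) \<boxplus> g = \<one>"
proof -
  have gB: "g \<in> carrier B" "g \<boxplus> \<one> = g"
    using g by (auto simp: add_part_iff)
  show "c \<boxplus> \<one> \<in> add_part B"
    using c by (simp add: add_part_iff sadd_assoc)
  show *: "g \<boxplus> (c \<boxplus> \<one>) = \<one>"
    using gB c gc by (simp add: sadd_assoc[symmetric])
  show "(c \<boxplus> \<one>) \<boxplus> g = \<one>"
  proof (rule sadd_left_cancel[of g])
    have "g \<boxplus> ((c \<boxplus> \<one>) \<boxplus> g) = (g \<boxplus> (c \<boxplus> \<one>)) \<boxplus> g"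
      using gB c by (subst sadd_assoc) auto
    then show "g \<boxplus> ((c \<boxplus> \<one>) \<boxplus> g) = g \<boxplus> \<one>"
      using gB by (simp add: *)
  qed (use gB c in auto)
qed

lemma add_group_group: "group (add_group B)"
proof (rule groupI)
  fix x assume "x \<in> carrier (add_group B)"
  then have x: "x \<in> add_part B" "x \<in> carrier B"
    by (auto simp: add_group_def add_part_iff)
  obtain c where c: "c \<in> carrier B" "x \<boxplus> c = \<one>"
    using right_inverse_ex[OF x(2)] .
  show "\<exists>y\<in>carrier (add_group B). y \<otimes>\<^bsub>add_group B\<^esub> x = \<one>\<^bsub>add_group B\<^esub>"
    using add_part_inverse[OF x(1) c] by (auto simp: add_group_def)
qed (auto simp: add_group_def add_part_iff sadd_assoc)

lemma add_group_inv:
  assumes "g \<in> add_part B" "c \<in> carrier B" "g \<boxplus> c = \<one>"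
  shows "inv\<^bsub>add_group B\<^esub> g = c \<boxplus> \<one>"
proof -
  interpret G: group "add_group B" by (rule add_group_group)
  show ?thesis
    using add_part_inverse[OF assms] assms(1)
    by (intro G.inv_equality) (auto simp: add_group_def)
qed


section \<open>Ideals containing the idempotents\<close>

text \<open>For subsets containing the idempotents the conditions on \<open>\<rho>\<close> and on the additive group
  \<open>G\<close> amount to invariance under every \<open>\<lambda>\<^sub>b\<close> and to additive normality in the whole semigroup.
  The latter is phrased with an element \<open>m\<close> such that \<open>n + b = b + m\<close>; such an \<open>m\<close> always
  exists and is unique.\<close>

lemma sb_ideal_iff:
  assumes EI: "idempotents B \<subseteq> I"
  shows "sb_ideal I B \<longleftrightarrow> I \<lhd> B \<and> (\<forall>a\<in>I. \<forall>b\<in>I. a \<boxplus> b \<in> I) \<and>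
    (\<forall>b\<in>carrier B. \<forall>x\<in>I. lam B b x \<in> I) \<and>
    (\<forall>b\<in>carrier B. \<forall>n\<in>I. \<forall>m\<in>carrier B. n \<boxplus> b = b \<boxplus> m \<longrightarrow> m \<in> I)"
    (is "_ \<longleftrightarrow> ?R")
proof
  assume id: "sb_ideal I B"
  interpret I: normal I B using id by (simp add: sb_ideal_def)
  interpret N: normal "I \<inter> add_part B" "add_group B" using id by (simp add: sb_ideal_def)
  have add: "a \<boxplus> b \<in> I" if "a \<in> I" "b \<in> I" for a b
    using id that by (simp add: sb_ideal_def)
  have rho: "rho B b n \<in> I" if "b \<in> carrier B" "n \<in> I \<inter> add_part B" for b n
    using id that by (simp add: sb_ideal_def)
  \<comment> \<open>This is the condition on \<open>\<rho>\<^sub>b(n\<^sup>-)\<close>, rewritten with \<open>m\<close>.\<close>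
  have key: "lam B (inv b) m \<in> I"
    if b: "b \<in> carrier B" and n: "n \<in> I \<inter> add_part B" and m: "m \<in> carrier B"
      and eq: "n \<boxplus> b = b \<boxplus> m" for b n m
  proof -
    have nB: "n \<in> carrier B" using n by auto
    have "lam B (inv n) \<one> = \<one>"
      using n nB by (simp add: lam_inv_one_iff)
    then have "lam B n \<one> = \<one>"
      using lam_lam_inv[OF nB one_closed] by simp
    then have inG: "inv n \<in> add_part B"
      using nB lam_inv_one_iff[of "inv n"] by simp
    have "rho B b (inv n) \<in> I"
      using b n inG by (intro rho) auto
    then have "inv (inv (n \<boxplus> b) \<otimes> b) \<in> I"
      using nB by (simp add: rho_def)
    then have "inv b \<otimes> (b \<boxplus> m) \<in> I"
      using b nB m by (simp add: inv_mult_group eq)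
    then show ?thesis
      using b m by (simp add: mult_sadd_lam)
  qed
  have lamG: "lam B (inv b) n \<in> I" if b: "b \<in> carrier B" and n: "n \<in> I \<inter> add_part B" for b n
  proof -
    have nB: "n \<in> carrier B" "n \<boxplus> \<one> = n" using n by (auto simp: add_part_iff)
    obtain c where c: "c \<in> carrier B" "b \<boxplus> c = \<one>"
      using right_inverse_ex[OF b] .
    have e: "c \<boxplus> b \<in> idempotents B"
      using right_inverse_idempotent[OF b c] .
    \<comment> \<open>Apply \<open>key\<close> to the conjugate \<open>g + n - g\<close> in \<open>G\<close>, where \<open>g = b + 0\<close>: moving it past \<open>b\<close> gives
      back \<open>n\<close>, up to an idempotent.\<close>
    let ?g = "b \<boxplus> \<one>"
    have g: "?g \<in> add_part B" using b by (simp add: add_part_def)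
    have gc: "?g \<boxplus> c = \<one>" using b c by (simp add: sadd_assoc)
    have "?g \<boxplus> n \<boxplus> (c \<boxplus> \<one>) \<in> I \<inter> add_part B"
      using N.inv_op_closed2[of ?g n] g n add_group_inv[OF g c(1) gc] by (simp add: add_group_def)
    moreover have "?g \<boxplus> n \<boxplus> (c \<boxplus> \<one>) \<boxplus> b = b \<boxplus> (n \<boxplus> (c \<boxplus> b))"
      using b c nB by (simp add: sadd_assoc)
    ultimately have "lam B (inv b) (n \<boxplus> (c \<boxplus> b)) \<in> I"
      using key b c nB by simp
    moreover have "lam B (inv b) \<one> \<in> I"
      using b EI lam_idempotent by auto
    ultimately have "lam B (inv b) (n \<boxplus> (c \<boxplus> b) \<boxplus> \<one>) \<in> I"
      using add b c nB by (subst lam_sadd) auto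
    moreover have "n \<boxplus> (c \<boxplus> b) \<boxplus> \<one> = n"
      using b c nB idempotent_sadd[OF e] by (simp add: sadd_assoc[of n "c \<boxplus> b"])
    ultimately show ?thesis by simp
  qed
  have lam: "lam B b x \<in> I" if b: "b \<in> carrier B" and x: "x \<in> I" for b x
  proof -
    have xB: "x \<in> carrier B" using x by auto
    obtain e where e: "e \<in> idempotents B" "x = (x \<boxplus> \<one>) \<boxplus> e"
      using sadd_one_idempotent_ex[OF xB] .
    have "x \<boxplus> \<one> \<in> I \<inter> add_part B"
      using x xB add by (auto simp: add_part_iff sadd_assoc)
    then have "lam B b (x \<boxplus> \<one>) \<in> I"
      using lamG[of "inv b"] b by simp
    moreover have "lam B b e \<in> I"
      using lam_idempotent b e EI by auto
    ultimately have "lam B b ((x \<boxplus> \<one>) \<boxplus> e) \<in> I"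
      using b xB e add idempotents_sub by (subst lam_sadd) auto
    then show ?thesis using e(2) by simp
  qed
  have "m \<in> I"
    if b: "b \<in> carrier B" and n: "n \<in> I" and m: "m \<in> carrier B" and eq: "n \<boxplus> b = b \<boxplus> m" for b n m
  proof -
    have nB: "n \<in> carrier B" using n by auto
    have "n \<boxplus> \<one> \<in> I \<inter> add_part B"
      using n nB add by (auto simp: add_part_iff sadd_assoc)
    moreover have "n \<boxplus> \<one> \<boxplus> b = b \<boxplus> m"
      using nB b eq by (simp add: sadd_assoc)
    ultimately have "lam B (inv b) m \<in> I"
      using key b m by blast
    then have "lam B b (lam B (inv b) m) \<in> I"
      using lam b by blast
    then show ?thesis using b m by simp
  qed
  then show ?R
    using I.normal_axioms add lam by blast
next
  assume R: ?R
  interpret I: normal I B using R by simp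
  have add: "a \<boxplus> b \<in> I" if "a \<in> I" "b \<in> I" for a b
    using R that by blast
  have lam: "lam B b x \<in> I" if "b \<in> carrier B" "x \<in> I" for b x
    using R that by blast
  have nrm: "m \<in> I" if "n \<boxplus> b = b \<boxplus> m" "n \<in> I" "b \<in> carrier B" "m \<in> carrier B" for b n m
    using R that by blast
  interpret G: group "add_group B" by (rule add_group_group)
  have G_simps: "carrier (add_group B) = add_part B" "monoid.mult (add_group B) = sadd B"
    "\<one>\<^bsub>add_group B\<^esub> = \<one>"
    by (simp_all add: add_group_def)
  have sub: "subgroup (I \<inter> add_part B) (add_group B)"
  proof (rule G.subgroupI)
    show "I \<inter> add_part B \<noteq> {}"
      using I.one_closed add_part_iff[of \<one>] one_sadd[OF one_closed] by blast
  next
    fix a assume a: "a \<in> I \<inter> add_part B"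
    have aB: "a \<in> carrier B" using a by auto
    let ?c = "lam B a (inv a)"
    have c: "?c \<in> carrier B" "a \<boxplus> ?c = \<one>"
      using aB by (simp_all add: mult_eq_sadd_lam[symmetric])
    have "?c \<in> I" using lam aB a by simp
    then show "inv\<^bsub>add_group B\<^esub> a \<in> I \<inter> add_part B"
      using a c add add_group_inv[of a ?c] add_part_inverse(1)[of a ?c] by auto
  next
    fix a b assume "a \<in> I \<inter> add_part B" "b \<in> I \<inter> add_part B"
    then show "a \<otimes>\<^bsub>add_group B\<^esub> b \<in> I \<inter> add_part B"
      using add by (auto simp: G_simps add_part_iff sadd_assoc)
  qed (auto simp: G_simps)
  have "(I \<inter> add_part B) \<lhd> add_group B"
    unfolding G.normal_inv_iff
  proof (intro conjI ballI)
    fix g n assume "g \<in> carrier (add_group B)" and n: "n \<in> I \<inter> add_part B"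
    then have g: "g \<in> add_part B" "g \<in> carrier B" by (auto simp: G_simps add_part_iff)
    obtain h0 where h0: "h0 \<in> carrier B" "g \<boxplus> h0 = \<one>"
      using right_inverse_ex[OF g(2)] .
    define h where "h = h0 \<boxplus> \<one>"
    have h: "h \<in> add_part B" "g \<boxplus> h = \<one>" "h \<boxplus> g = \<one>" "inv\<^bsub>add_group B\<^esub> g = h"
      using add_part_inverse[OF g(1) h0] add_group_inv[OF g(1) h0] by (auto simp: h_def)
    have B: "h \<in> carrier B" "n \<in> carrier B" "h \<boxplus> \<one> = h" "g \<boxplus> \<one> = g" "n \<boxplus> \<one> = n"
      using h(1) n g by (auto simp: add_part_iff)
    have "n \<boxplus> h = h \<boxplus> (g \<boxplus> n \<boxplus> h)"
      using g B h(3) by (simp add: sadd_assoc[symmetric])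
    then have "g \<boxplus> n \<boxplus> h \<in> I"
      using g B n nrm[of n h "g \<boxplus> n \<boxplus> h"] by simp
    moreover have "g \<boxplus> n \<boxplus> h \<in> add_part B"
      using g B by (simp add: add_part_iff sadd_assoc)
    ultimately show "g \<otimes>\<^bsub>add_group B\<^esub> n \<otimes>\<^bsub>add_group B\<^esub> inv\<^bsub>add_group B\<^esub> g \<in> I \<inter> add_part B"
      by (simp add: G_simps h)
  qed (rule sub)
  moreover have "rho B b n \<in> I" if b: "b \<in> carrier B" and n: "n \<in> I" for b n
  proof -
    have nB: "inv n \<in> carrier B" using n by auto
    obtain c where c: "c \<in> carrier B" "b \<boxplus> c = \<one>"
      using right_inverse_ex[OF b] .
    let ?m = "c \<boxplus> (inv n \<boxplus> b)"
    have eq: "inv n \<boxplus> b = b \<boxplus> ?m"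
      using b nB c by (simp add: sadd_assoc[symmetric])
    have "?m \<in> I"
      using b n c nB by (intro nrm[OF eq]) auto
    then have l: "lam B (inv b) ?m \<in> I"
      using lam b by blast
    then have lB: "lam B (inv b) ?m \<in> carrier B" by auto
    have "rho B b n = inv (b \<boxplus> ?m) \<otimes> b"
      by (simp only: rho_def eq[symmetric])
    also have "\<dots> = inv (b \<otimes> lam B (inv b) ?m) \<otimes> b"
      using b c nB by (subst sadd_eq_mult_lam) auto
    also have "\<dots> = inv (lam B (inv b) ?m)"
      using b lB by (simp add: inv_mult_group m_assoc)
    finally show ?thesis using l by simp
  qed
  ultimately show "sb_ideal I B"
    using I.normal_axioms add lam by (auto simp: sb_ideal_def add_part_iff)
qed

end

text \<open>An ideal that contains all idempotents. Its multiplicative cosets are the additive left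
  cosets \<open>a + I\<close>.\<close>

locale idempotent_ideal = left_semi_brace +
  fixes I
  assumes ideal: "sb_ideal I B"
    and idempotents_sub_ideal: "idempotents B \<subseteq> I"
begin

sublocale normal I B
  using ideal by (simp add: sb_ideal_def)

lemma ideal_sadd: "\<lbrakk>a \<in> I; b \<in> I\<rbrakk> \<Longrightarrow> a \<boxplus> b \<in> I"
  using ideal by (simp add: sb_ideal_def)

lemma ideal_lam: "\<lbrakk>b \<in> carrier B; x \<in> I\<rbrakk> \<Longrightarrow> lam B b x \<in> I"
  using ideal sb_ideal_iff[OF idempotents_sub_ideal] by blast

lemma ideal_sadd_commute:
  assumes b: "b \<in> carrier B" and n: "n \<in> I"
  obtains m where "m \<in> I" "n \<boxplus> b = b \<boxplus> m"
proof -
  obtain c where c: "c \<in> carrier B" "b \<boxplus> c = \<one>"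
    using right_inverse_ex[OF b] .
  have nB: "n \<in> carrier B" using n by auto
  have eq: "n \<boxplus> b = b \<boxplus> (c \<boxplus> (n \<boxplus> b))"
    using b c nB by (simp add: sadd_assoc[symmetric])
  then have "c \<boxplus> (n \<boxplus> b) \<in> I"
    using ideal sb_ideal_iff[OF idempotents_sub_ideal] b c n nB by blast
  then show ?thesis using eq that by blast
qed

lemma mem_rcos_iff:
  assumes a: "a \<in> carrier B"
  shows "x \<in> I #> a \<longleftrightarrow> (\<exists>i\<in>I. x = a \<boxplus> i)"
proof -
  have "x \<in> I #> a \<longleftrightarrow> (\<exists>i\<in>I. x = a \<otimes> i)"
    using coset_eq a by (auto simp: l_coset_def)
  also have "\<dots> \<longleftrightarrow> (\<exists>i\<in>I. x = a \<boxplus> i)"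
  proof
    assume "\<exists>i\<in>I. x = a \<otimes> i"
    then obtain i where "i \<in> I" "x = a \<otimes> i" by blast
    then show "\<exists>i\<in>I. x = a \<boxplus> i"
      using a ideal_lam[of a i] by (auto simp: mult_eq_sadd_lam)
  next
    assume "\<exists>i\<in>I. x = a \<boxplus> i"
    then obtain i where "i \<in> I" "x = a \<boxplus> i" by blast
    then show "\<exists>i\<in>I. x = a \<otimes> i"
      using a ideal_lam[of "inv a" i] sadd_eq_mult_lam[of a i] by auto
  qed
  finally show ?thesis .
qed

lemma rcos_eq_iff:
  assumes "a \<in> carrier B" "b \<in> carrier B"
  shows "I #> a = I #> b \<longleftrightarrow> (\<exists>i\<in>I. a = b \<boxplus> i)"
  using assms mem_rcos_iff[of b a] repr_independence[of a I b] rcos_self[of a I] subgroup_axioms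
  by auto

lemma rcos_eq_I_iff:
  assumes "a \<in> carrier B"
  shows "I #> a = I \<longleftrightarrow> a \<in> I"
  using assms subset rcos_eq_iff[of a \<one>] coset_mult_one[of I] by auto

abbreviation Q where "Q \<equiv> sb_quotient B I"

lemma quotient_carrier: "carrier Q = (\<lambda>a. I #> a) ` carrier B"
  by (auto simp: sb_quotient_def FactGroup_def RCOSETS_def)

lemma quotient_one [simp]: "\<one>\<^bsub>Q\<^esub> = I"
  by (simp add: sb_quotient_def FactGroup_def)

lemma quotient_mult [simp]:
  "\<lbrakk>a \<in> carrier B; b \<in> carrier B\<rbrakk> \<Longrightarrow> (I #> a) \<otimes>\<^bsub>Q\<^esub> (I #> b) = I #> (a \<otimes> b)"
  by (simp add: sb_quotient_def FactGroup_def rcos_sum)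

lemma quotient_sadd [simp]:
  assumes a: "a \<in> carrier B" and b: "b \<in> carrier B"
  shows "(I #> a) \<boxplus>\<^bsub>Q\<^esub> (I #> b) = I #> (a \<boxplus> b)"
proof -
  have "I #> (a' \<boxplus> b') = I #> (a \<boxplus> b)" if mem: "a' \<in> I #> a" "b' \<in> I #> b" for a' b'
  proof -
    obtain i j where ij: "i \<in> I" "j \<in> I" "a' = a \<boxplus> i" "b' = b \<boxplus> j"
      using mem a b by (auto simp: mem_rcos_iff)
    obtain m where m: "m \<in> I" "i \<boxplus> b = b \<boxplus> m"
      using ideal_sadd_commute[OF b ij(1)] .
    have B: "i \<in> carrier B" "j \<in> carrier B" "m \<in> carrier B"
      using ij m by auto
    have "a' \<boxplus> b' = a \<boxplus> (i \<boxplus> b) \<boxplus> j"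
      using a b B by (simp add: ij sadd_assoc)
    also have "\<dots> = (a \<boxplus> b) \<boxplus> (m \<boxplus> j)"
      using a b B by (simp add: m sadd_assoc)
    finally show ?thesis
      using a b B ij m ideal_sadd[of m j] by (subst rcos_eq_iff) auto
  qed
  then have "(\<Union>a'\<in>I #> a. \<Union>b'\<in>I #> b. I #> (a' \<boxplus> b')) =
      (\<Union>a'\<in>I #> a. \<Union>b'\<in>I #> b. I #> (a \<boxplus> b))"
    by (intro SUP_cong refl)
  moreover have "a \<in> I #> a" "b \<in> I #> b"
    using a b rcos_self subgroup_axioms by auto
  ultimately show ?thesis
    by (auto simp: sb_quotient_def)
qed

lemma quotient_group: "group Q"
  using factorgroup_is_group
  by (simp add: group_def monoid_def group_axioms_def Units_def sb_quotient_def)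

lemma quotient_group_hom: "group_hom B Q (\<lambda>a. I #> a)"
  using quotient_group
  by (auto simp: group_hom_def group_hom_axioms_def hom_def quotient_carrier)

lemma quotient_inv [simp]: "a \<in> carrier B \<Longrightarrow> inv\<^bsub>Q\<^esub> (I #> a) = I #> inv a"
  using group_hom.hom_inv[OF quotient_group_hom] by simp

lemma quotient_left_semi_brace: "left_semi_brace Q"
proof -
  interpret Q: group Q by (rule quotient_group)
  show ?thesis
  proof
    fix X Y Z assume "X \<in> carrier Q" "Y \<in> carrier Q" "Z \<in> carrier Q"
    then obtain a b c where abc: "a \<in> carrier B" "b \<in> carrier B" "c \<in> carrier B"
        "X = I #> a" "Y = I #> b" "Z = I #> c"
      by (auto simp: quotient_carrier)
    show "(X \<boxplus>\<^bsub>Q\<^esub> Y) \<boxplus>\<^bsub>Q\<^esub> Z = X \<boxplus>\<^bsub>Q\<^esub> (Y \<boxplus>\<^bsub>Q\<^esub> Z)"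
      using abc by (simp add: sadd_assoc)
    show "X \<otimes>\<^bsub>Q\<^esub> (Y \<boxplus>\<^bsub>Q\<^esub> Z) = (X \<otimes>\<^bsub>Q\<^esub> Y) \<boxplus>\<^bsub>Q\<^esub> (X \<otimes>\<^bsub>Q\<^esub> (inv\<^bsub>Q\<^esub> X \<boxplus>\<^bsub>Q\<^esub> Z))"
      using abc mult_sadd[of a b c] by simp
    assume "X \<boxplus>\<^bsub>Q\<^esub> Y = X \<boxplus>\<^bsub>Q\<^esub> Z"
    then obtain i where i: "i \<in> I" "a \<boxplus> b = (a \<boxplus> c) \<boxplus> i"
      using abc by (auto simp: rcos_eq_iff)
    then have "b = c \<boxplus> i"
      using abc sadd_left_cancel[of a b "c \<boxplus> i"] by (auto simp: sadd_assoc)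
    then show "Y = Z"
      using i abc by (auto simp: rcos_eq_iff)
  next
    fix X Y assume "X \<in> carrier Q" "Y \<in> carrier Q"
    then show "X \<boxplus>\<^bsub>Q\<^esub> Y \<in> carrier Q"
      by (auto simp: quotient_carrier)
  qed
qed

lemma quotient_lam:
  "\<lbrakk>a \<in> carrier B; b \<in> carrier B\<rbrakk> \<Longrightarrow> lam Q (I #> a) (I #> b) = I #> lam B a b"
  by (simp add: lam_def)

text \<open>The quotient has no idempotent besides its identity, so its addition is a group.\<close>

lemma quotient_idempotents: "idempotents Q = {I}"
proof -
  interpret Q: left_semi_brace Q by (rule quotient_left_semi_brace)
  have "X = I" if X: "X \<in> idempotents Q" for X
  proof -
    obtain a where a: "a \<in> carrier B" "X = I #> a" "I #> (a \<boxplus> a) = I #> a"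
      using X by (auto simp: idempotents_def quotient_carrier)
    then obtain i where i: "i \<in> I" "a \<boxplus> a = a \<boxplus> i"
      by (auto simp: rcos_eq_iff)
    then have "a = i"
      using a sadd_left_cancel[of a a i] by auto
    then show ?thesis
      using i a by (simp add: rcos_eq_I_iff)
  qed
  then show ?thesis
    using Q.one_idempotent by auto
qed

lemma sb_ideal_vimage:
  assumes K: "sb_ideal K Q"
  shows "sb_ideal {a \<in> carrier B. I #> a \<in> K} B" and "I \<subseteq> {a \<in> carrier B. I #> a \<in> K}"
proof -
  interpret Q: left_semi_brace Q by (rule quotient_left_semi_brace)
  interpret K: normal K Q using K by (simp add: sb_ideal_def)
  let ?J = "{a \<in> carrier B. I #> a \<in> K}"
  have "idempotents Q \<subseteq> K"
    using K.one_closed by (simp add: quotient_idempotents)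
  note K' = Q.sb_ideal_iff[OF this, THEN iffD1, OF K]
  show IJ: "I \<subseteq> ?J"
  proof
    fix i assume "i \<in> I"
    then show "i \<in> ?J"
      using K.one_closed rcos_eq_I_iff[of i] by auto
  qed
  have sub: "subgroup ?J B"
  proof (rule subgroupI)
    show "?J \<noteq> {}" using IJ one_closed by blast
  next
    fix a assume a: "a \<in> ?J"
    then have "inv\<^bsub>Q\<^esub> (I #> a) \<in> K" by blast
    then show "inv a \<in> ?J" using a by simp
  next
    fix a b assume ab: "a \<in> ?J" "b \<in> ?J"
    then have "(I #> a) \<otimes>\<^bsub>Q\<^esub> (I #> b) \<in> K" by blast
    then show "a \<otimes> b \<in> ?J" using ab by simp
  qed auto
  have nrm: "?J \<lhd> B"
    unfolding normal_inv_iff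
  proof (intro conjI ballI)
    fix x h assume x: "x \<in> carrier B" and h: "h \<in> ?J"
    have "(I #> x) \<otimes>\<^bsub>Q\<^esub> (I #> h) \<otimes>\<^bsub>Q\<^esub> inv\<^bsub>Q\<^esub> (I #> x) \<in> K"
      using x h by (intro K.inv_op_closed2) (auto simp: quotient_carrier)
    then show "x \<otimes> h \<otimes> inv x \<in> ?J"
      using x h by simp
  qed (rule sub)
  show "sb_ideal ?J B"
  proof (subst sb_ideal_iff, goal_cases)
    case 1 show ?case using IJ idempotents_sub_ideal by blast
  next
    case 2
    have "a \<boxplus> b \<in> ?J" if ab: "a \<in> ?J" "b \<in> ?J" for a b
    proof -
      have "(I #> a) \<boxplus>\<^bsub>Q\<^esub> (I #> b) \<in> K" using K' ab by blast
      then show ?thesis using ab by simp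
    qed
    moreover have "lam B b x \<in> ?J" if b: "b \<in> carrier B" and x: "x \<in> ?J" for b x
    proof -
      have "lam Q (I #> b) (I #> x) \<in> K" using K' b x by (auto simp: quotient_carrier)
      then show ?thesis using b x by (simp add: quotient_lam)
    qed
    moreover have "m \<in> ?J"
      if b: "b \<in> carrier B" and n: "n \<in> ?J" and m: "m \<in> carrier B" and eq: "n \<boxplus> b = b \<boxplus> m"
      for b n m
    proof -
      have "(I #> n) \<boxplus>\<^bsub>Q\<^esub> (I #> b) = (I #> b) \<boxplus>\<^bsub>Q\<^esub> (I #> m)"
        using b n m eq by simp
      then have "I #> m \<in> K"
        using K' b n m by (auto simp: quotient_carrier)
      then show ?thesis using m by simp
    qed
    ultimately show ?case using nrm by blast
  qed
qed

end


section \<open>The socle and the generalized socle\<close>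

context left_semi_brace
begin

text \<open>The condition on \<open>\<lambda>\<close> says that products with \<open>a\<close> on the left are sums; given this, the one
  on \<open>\<rho>\<close> says that \<open>a\<close> commutes additively with every element, up to adding \<open>0\<close> on the right.\<close>

lemma Soc_iff:
  "a \<in> Soc B \<longleftrightarrow> a \<in> carrier B \<and> (\<forall>x\<in>carrier B. a \<otimes> x = a \<boxplus> x \<and> a \<boxplus> x \<boxplus> \<one> = x \<boxplus> a)"
proof (cases "a \<in> carrier B")
  case a: True
  have lam: "lam B a x = lam B \<one> x \<longleftrightarrow> a \<otimes> x = a \<boxplus> x" if "x \<in> carrier B" for x
    using a that sadd_left_cancel[of a "lam B a x" x] by (auto simp: mult_eq_sadd_lam)
  have rho: "rho B a (inv x) = rho B \<one> (inv x) \<longleftrightarrow> x \<boxplus> a = a \<otimes> (x \<boxplus> \<one>)"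
    if x: "x \<in> carrier B" for x
  proof -
    have "rho B a (inv x) = rho B \<one> (inv x) \<longleftrightarrow> inv (x \<boxplus> a) \<otimes> a = inv (x \<boxplus> \<one>)"
      using a x by (simp add: rho_def)
    also have "\<dots> \<longleftrightarrow> inv (inv (x \<boxplus> a) \<otimes> a) = x \<boxplus> \<one>"
      using a x inv_inv[of "inv (x \<boxplus> a) \<otimes> a"] inv_inv[of "x \<boxplus> \<one>"] by fastforce
    also have "\<dots> \<longleftrightarrow> inv a \<otimes> (x \<boxplus> a) = x \<boxplus> \<one>"
      using a x by (simp add: inv_mult_group)
    also have "\<dots> \<longleftrightarrow> x \<boxplus> a = a \<otimes> (x \<boxplus> \<one>)"
      using a x by (simp add: inv_solve_left')
    finally show ?thesis .
  qed
  have "(\<forall>b\<in>carrier B. rho B a b = rho B \<one> b) \<longleftrightarrow>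
      (\<forall>x\<in>carrier B. rho B a (inv x) = rho B \<one> (inv x))"
    by (metis inv_closed inv_inv)
  then have "a \<in> Soc B \<longleftrightarrow> (\<forall>x\<in>carrier B. x \<boxplus> a = a \<otimes> (x \<boxplus> \<one>)) \<and>
      (\<forall>x\<in>carrier B. a \<otimes> x = a \<boxplus> x)"
    using a rho lam by (simp add: Soc_def)
  also have "\<dots> \<longleftrightarrow> (\<forall>x\<in>carrier B. a \<otimes> x = a \<boxplus> x \<and> a \<boxplus> x \<boxplus> \<one> = x \<boxplus> a)"
    using a by (auto simp: sadd_assoc)
  finally show ?thesis using a by simp
qed (simp add: Soc_def)

lemma Soc_carrier: "s \<in> Soc B \<Longrightarrow> s \<in> carrier B"
  by (simp add: Soc_iff)

lemma Soc_mult: "\<lbrakk>s \<in> Soc B; x \<in> carrier B\<rbrakk> \<Longrightarrow> s \<otimes> x = s \<boxplus> x"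
  by (simp add: Soc_iff)

lemma Soc_sadd_one: "s \<in> Soc B \<Longrightarrow> s \<boxplus> \<one> = s"
  using Soc_mult[of s \<one>] by (simp add: Soc_carrier)

lemma Soc_commute: "\<lbrakk>s \<in> Soc B; x \<in> carrier B\<rbrakk> \<Longrightarrow> s \<boxplus> (x \<boxplus> \<one>) = x \<boxplus> s"
  by (simp add: Soc_iff flip: sadd_assoc)

lemma Soc_lam: "\<lbrakk>s \<in> Soc B; x \<in> carrier B\<rbrakk> \<Longrightarrow> lam B s x = x"
  by (simp add: Soc_def)

lemma one_Soc: "\<one> \<in> Soc B"
  by (simp add: Soc_iff)

lemma Soc_subgroup: "subgroup (Soc B) B"
proof (rule subgroupI)
  show "Soc B \<noteq> {}" using one_Soc by blast
next
  fix s assume s: "s \<in> Soc B"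
  have sB: "s \<in> carrier B" using s by (rule Soc_carrier)
  have ss: "s \<boxplus> inv s = \<one>" using Soc_mult[OF s, of "inv s"] sB by simp
  have s1: "inv s \<boxplus> \<one> = inv s"
    using sadd_left_cancel[of s "inv s \<boxplus> \<one>" "inv s"] sB ss by (simp add: sadd_assoc[symmetric])
  have "inv s \<otimes> x = inv s \<boxplus> x \<and> inv s \<boxplus> x \<boxplus> \<one> = x \<boxplus> inv s" if x: "x \<in> carrier B" for x
  proof
    have "s \<boxplus> (inv s \<otimes> x) = s \<otimes> (inv s \<otimes> x)"
      using Soc_mult[OF s] sB x by simp
    also have "\<dots> = s \<boxplus> (inv s \<boxplus> x)"
      using sB x ss by (simp add: sadd_assoc[symmetric]) (simp add: m_assoc[symmetric])
    finally show "inv s \<otimes> x = inv s \<boxplus> x"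
      using sadd_left_cancel[of s "inv s \<otimes> x" "inv s \<boxplus> x"] sB x by simp
    have "s \<boxplus> (x \<boxplus> inv s) = s \<boxplus> (x \<boxplus> \<one>) \<boxplus> inv s"
      using sB x by (simp add: sadd_assoc)
    also have "\<dots> = x \<boxplus> s \<boxplus> inv s"
      using Soc_commute[OF s x] by simp
    also have "\<dots> = x \<boxplus> \<one>"
      using sB x ss by (simp add: sadd_assoc)
    also have "\<dots> = s \<boxplus> (inv s \<boxplus> x \<boxplus> \<one>)"
      using sB x ss by (simp add: sadd_assoc[symmetric])
    finally show "inv s \<boxplus> x \<boxplus> \<one> = x \<boxplus> inv s"
      using sadd_left_cancel[of s "inv s \<boxplus> x \<boxplus> \<one>" "x \<boxplus> inv s"] sB x by simp
  qed
  then show "inv s \<in> Soc B" using sB by (simp add: Soc_iff)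
next
  fix s t assume s: "s \<in> Soc B" and t: "t \<in> Soc B"
  have B: "s \<in> carrier B" "t \<in> carrier B" using s t Soc_carrier by auto
  have st: "s \<otimes> t = s \<boxplus> t" using Soc_mult s B by simp
  have ts: "t \<boxplus> s = s \<boxplus> t"
    using Soc_commute[OF s, of t] Soc_sadd_one[OF t] B by simp
  have "s \<otimes> t \<otimes> x = s \<otimes> t \<boxplus> x \<and> s \<otimes> t \<boxplus> x \<boxplus> \<one> = x \<boxplus> s \<otimes> t" if x: "x \<in> carrier B" for x
  proof
    show "s \<otimes> t \<otimes> x = s \<otimes> t \<boxplus> x"
      using B x by (simp add: st[symmetric] m_assoc)
        (simp add: st sadd_assoc Soc_mult[OF s] Soc_mult[OF t])
    have "s \<otimes> t \<boxplus> x \<boxplus> \<one> = s \<boxplus> (t \<boxplus> (x \<boxplus> \<one>))"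
      using B x by (simp add: st sadd_assoc)
    also have "\<dots> = s \<boxplus> (x \<boxplus> t)" using Soc_commute[OF t x] by simp
    also have "\<dots> = s \<boxplus> (x \<boxplus> t \<boxplus> \<one>)"
      using B x by (simp add: sadd_assoc Soc_sadd_one[OF t])
    also have "\<dots> = x \<boxplus> t \<boxplus> s" using Soc_commute[OF s, of "x \<boxplus> t"] B x by simp
    also have "\<dots> = x \<boxplus> s \<otimes> t" using B x by (simp add: st sadd_assoc ts)
    finally show "s \<otimes> t \<boxplus> x \<boxplus> \<one> = x \<boxplus> s \<otimes> t" .
  qed
  then show "s \<otimes> t \<in> Soc B" using B by (simp add: Soc_iff)
qed (auto simp: Soc_carrier)

text \<open>The conjugate of a socle element \<open>s\<close> lies in the kernel of \<open>\<lambda>\<close>, so its products are sums;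
  pulling \<open>s\<close> through a sum by \<open>\<lambda>\<^sub>b\<close> then identifies the conjugate with \<open>\<lambda>\<^sub>b(s) + 0\<close> and shows
  that it is additively central.\<close>

lemma Soc_conj:
  assumes b: "b \<in> carrier B" and s: "s \<in> Soc B"
  shows "b \<otimes> s \<otimes> inv b = lam B b s \<boxplus> \<one>" "b \<otimes> s \<otimes> inv b \<in> Soc B"
proof -
  have sB: "s \<in> carrier B" using s by (rule Soc_carrier)
  let ?c = "b \<otimes> s \<otimes> inv b"
  have cB: "?c \<in> carrier B" using b sB by simp
  have lamc: "lam B ?c x = x" if "x \<in> carrier B" for x
    using that b sB by (simp add: lam_mult Soc_lam[OF s])
  have mult: "?c \<otimes> x = ?c \<boxplus> x" if "x \<in> carrier B" for x
    using mult_eq_sadd_lam[of ?c x] lamc that cB by simp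
  have comm: "?c \<boxplus> x \<boxplus> \<one> = x \<boxplus> (lam B b s \<boxplus> \<one>)" if x: "x \<in> carrier B" for x
  proof -
    define y where "y = inv b \<otimes> x"
    have y: "y \<in> carrier B" "b \<otimes> y = x"
      using b x by (auto simp: y_def m_assoc[symmetric])
    obtain f where f: "f \<in> idempotents B" "y = (y \<boxplus> \<one>) \<boxplus> f"
      using sadd_one_idempotent_ex[OF y(1)] .
    have fB: "f \<in> carrier B" using f idempotents_sub by blast
    have "s \<otimes> y = s \<boxplus> ((y \<boxplus> \<one>) \<boxplus> f)"
      using Soc_mult[OF s y(1)] f(2) by simp
    also have "\<dots> = (s \<boxplus> (y \<boxplus> \<one>)) \<boxplus> f"
      using sB y fB by (simp add: sadd_assoc)
    also have "\<dots> = y \<boxplus> (s \<boxplus> f)"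
      using Soc_commute[OF s y(1)] sB y fB by (simp add: sadd_assoc)
    finally have sy: "s \<otimes> y = y \<boxplus> (s \<boxplus> f)" .
    have "?c \<boxplus> x = ?c \<otimes> x" using mult x by simp
    also have "\<dots> = b \<otimes> (s \<otimes> y)"
      using b sB x by (simp add: y_def m_assoc)
    also have "\<dots> = x \<boxplus> (lam B b s \<boxplus> lam B b f)"
      using b sB y fB by (simp add: sy mult_sadd_lam lam_sadd)
    finally have "?c \<boxplus> x = x \<boxplus> (lam B b s \<boxplus> lam B b f)" .
    moreover have "lam B b f \<boxplus> \<one> = \<one>"
      using idempotent_sadd[OF lam_idempotent[OF b f(1)]] by simp
    ultimately show ?thesis
      using b sB x fB by (simp add: sadd_assoc)
  qed
  have c1: "?c \<boxplus> \<one> = ?c" using mult[of \<one>] cB by simp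
  show eq: "?c = lam B b s \<boxplus> \<one>"
    using comm[of \<one>] b sB by (simp only: c1 one_sadd one_closed sadd_closed lam_closed)
  show "?c \<in> Soc B"
    unfolding Soc_iff using cB mult comm by (simp flip: eq)
qed

lemma mem_Zoc_iff: "x \<in> Zoc B \<longleftrightarrow> (\<exists>s\<in>Soc B. \<exists>e\<in>idempotents B. x = s \<otimes> e)"
proof -
  have "s \<boxplus> e = s \<otimes> e" if "s \<in> Soc B" "e \<in> idempotents B" for s e
    using that Soc_mult idempotents_sub by auto
  then show ?thesis
    by (auto simp: Zoc_def) metis+
qed

lemma idempotents_sub_Zoc: "idempotents B \<subseteq> Zoc B"
  using one_Soc idempotents_sub by (force simp: mem_Zoc_iff)

lemma Zoc_normal:
  assumes "idempotents B \<lhd> B"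
  shows "Zoc B \<lhd> B"
proof -
  interpret E: normal "idempotents B" B by (rule assms)
  interpret S: subgroup "Soc B" B by (rule Soc_subgroup)
  have "subgroup (Zoc B) B"
  proof (rule subgroupI)
    show "Zoc B \<subseteq> carrier B" by (auto simp: mem_Zoc_iff)
    show "Zoc B \<noteq> {}" using idempotents_sub_Zoc one_idempotent by blast
  next
    fix x assume "x \<in> Zoc B"
    then obtain s e where se: "s \<in> Soc B" "e \<in> idempotents B" "x = s \<otimes> e"
      by (auto simp: mem_Zoc_iff)
    then have "inv x = inv s \<otimes> (s \<otimes> inv e \<otimes> inv s)"
      by (simp add: inv_mult_group m_assoc[symmetric])
    then show "inv x \<in> Zoc B"
      using se E.inv_op_closed2[of s "inv e"] S.m_inv_closed[of s] E.m_inv_closed[of e]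
        S.mem_carrier[of s]
      unfolding mem_Zoc_iff by blast
  next
    fix x y assume "x \<in> Zoc B" "y \<in> Zoc B"
    then obtain s e t f where st: "s \<in> Soc B" "e \<in> idempotents B" "x = s \<otimes> e"
      "t \<in> Soc B" "f \<in> idempotents B" "y = t \<otimes> f"
      by (auto simp: mem_Zoc_iff)
    then have "x \<otimes> y = (s \<otimes> t) \<otimes> ((inv t \<otimes> e \<otimes> t) \<otimes> f)"
      by (simp add: m_assoc inv_solve_left) (simp add: m_assoc[symmetric])
    then show "x \<otimes> y \<in> Zoc B"
      using st E.inv_op_closed1[of t e] S.m_closed[of s t] E.m_closed[of "inv t \<otimes> e \<otimes> t" f]
        S.mem_carrier[of t]
      unfolding mem_Zoc_iff by blast
  qed
  moreover have "b \<otimes> x \<otimes> inv b \<in> Zoc B" if b: "b \<in> carrier B" and x: "x \<in> Zoc B" for b x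
  proof -
    obtain s e where se: "s \<in> Soc B" "e \<in> idempotents B" "x = s \<otimes> e"
      using x by (auto simp: mem_Zoc_iff)
    have B: "s \<in> carrier B" "e \<in> carrier B" using se by auto
    have "inv b \<otimes> (b \<otimes> (e \<otimes> inv b)) = e \<otimes> inv b"
      using b B by (simp add: m_assoc[symmetric])
    then have "b \<otimes> x \<otimes> inv b = (b \<otimes> s \<otimes> inv b) \<otimes> (b \<otimes> e \<otimes> inv b)"
      using b B se(3) by (simp add: m_assoc)
    then show ?thesis
      using Soc_conj(2)[OF b se(1)] E.inv_op_closed2[OF b se(2)] unfolding mem_Zoc_iff by blast
  qed
  ultimately show ?thesis
    by (simp add: normal_inv_iff)
qed

lemma sb_ideal_Zoc:
  assumes "idempotents B \<lhd> B"
  shows "sb_ideal (Zoc B) B"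
proof -
  have EB: "e \<in> carrier B" if "e \<in> idempotents B" for e using that idempotents_sub by blast
  have ZI: "s \<boxplus> e \<in> Zoc B" if "s \<in> Soc B" "e \<in> idempotents B" for s e
    using that by (auto simp: Zoc_def)
  have ZE: thesis if "x \<in> Zoc B"
    "\<And>s e. \<lbrakk>s \<in> Soc B; e \<in> idempotents B; s \<in> carrier B; e \<in> carrier B; x = s \<boxplus> e\<rbrakk> \<Longrightarrow> thesis"
    for x thesis
    using that EB Soc_carrier by (auto simp: Zoc_def)
  have "x \<boxplus> y \<in> Zoc B" if xy: "x \<in> Zoc B" "y \<in> Zoc B" for x y
  proof -
    obtain s e where s: "s \<in> Soc B" "e \<in> idempotents B" "s \<in> carrier B" "e \<in> carrier B"
      "x = s \<boxplus> e"
      using xy(1) by (rule ZE)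
    obtain t f where t: "t \<in> Soc B" "f \<in> idempotents B" "t \<in> carrier B" "f \<in> carrier B"
      "y = t \<boxplus> f"
      using xy(2) by (rule ZE)
    have "x \<boxplus> y = (s \<otimes> t) \<boxplus> f"
      using s t by (simp add: sadd_assoc Soc_mult idempotent_sadd)
    then show ?thesis
      using ZI s t subgroup.m_closed[OF Soc_subgroup] by simp
  qed
  moreover have "lam B b x \<in> Zoc B" if b: "b \<in> carrier B" and x: "x \<in> Zoc B" for b x
  proof -
    obtain s e where s: "s \<in> Soc B" "e \<in> idempotents B" "s \<in> carrier B" "e \<in> carrier B"
      "x = s \<boxplus> e"
      using x by (rule ZE)
    have "lam B b x = (lam B b s \<boxplus> \<one>) \<boxplus> lam B b e"
      using b s by (simp add: lam_sadd sadd_assoc)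
    also have "lam B b s \<boxplus> \<one> = b \<otimes> s \<otimes> inv b"
      using Soc_conj(1)[OF b s(1)] by simp
    finally show ?thesis
      using ZI Soc_conj(2)[OF b s(1)] lam_idempotent[OF b s(2)] by simp
  qed
  moreover have "m \<in> Zoc B"
    if b: "b \<in> carrier B" and n: "n \<in> Zoc B" and m: "m \<in> carrier B" and eq: "n \<boxplus> b = b \<boxplus> m"
    for b n m
  proof -
    obtain s e where s: "s \<in> Soc B" "e \<in> idempotents B" "s \<in> carrier B" "e \<in> carrier B"
      "n = s \<boxplus> e"
      using n by (rule ZE)
    obtain f where f: "f \<in> idempotents B" "b = (b \<boxplus> \<one>) \<boxplus> f"
      using sadd_one_idempotent_ex[OF b] .
    have "b \<boxplus> m = s \<boxplus> b" using b s eq by (simp add: sadd_assoc idempotent_sadd)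
    also have "\<dots> = s \<boxplus> ((b \<boxplus> \<one>) \<boxplus> f)" using f(2) by simp
    also have "\<dots> = s \<boxplus> (b \<boxplus> \<one>) \<boxplus> f"
      using b s EB[OF f(1)] by (simp add: sadd_assoc)
    also have "\<dots> = b \<boxplus> (s \<boxplus> f)"
      using b s EB[OF f(1)] Soc_commute[OF s(1) b] by (simp add: sadd_assoc)
    finally have "m = s \<boxplus> f"
      using sadd_left_cancel[of b m "s \<boxplus> f"] b m s EB[OF f(1)] by simp
    then show ?thesis using ZI s f by simp
  qed
  ultimately show ?thesis
    using Zoc_normal[OF assms] unfolding sb_ideal_iff[OF idempotents_sub_Zoc] by blast
qed

end


section \<open>The generalized socle series\<close>

context idempotent_ideal
begin

text \<open>Membership in the preimage of \<open>Soc (B/I)\<close> as a family of congruences modulo \<open>I\<close>.\<close>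

lemma rcos_mem_Soc_iff:
  assumes a: "a \<in> carrier B"
  shows "I #> a \<in> Soc Q \<longleftrightarrow>
    (\<forall>x\<in>carrier B. I #> (a \<otimes> x) = I #> (a \<boxplus> x) \<and> I #> (a \<boxplus> x \<boxplus> \<one>) = I #> (x \<boxplus> a))"
proof -
  interpret Q: left_semi_brace Q by (rule quotient_left_semi_brace)
  have "\<one>\<^bsub>Q\<^esub> = I #> \<one>"
    using coset_mult_one[OF subset] by simp
  then show ?thesis
    using a by (auto simp: Q.Soc_iff quotient_carrier simp del: quotient_one)
qed

lemma quotient_Zoc: "Zoc Q = Soc Q"
proof -
  interpret Q: left_semi_brace Q by (rule quotient_left_semi_brace)
  show ?thesis
    using Q.Soc_sadd_one by (force simp: Zoc_def quotient_idempotents)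
qed

lemma sb_ideal_Soc_quotient: "sb_ideal (Soc Q) Q"
proof -
  interpret Q: left_semi_brace Q by (rule quotient_left_semi_brace)
  have "idempotents Q \<lhd> Q"
    using Q.one_is_normal by (simp add: quotient_idempotents)
  then show ?thesis
    using Q.sb_ideal_Zoc by (simp add: quotient_Zoc)
qed

text \<open>The definite description in the recursion for the generalized socle series denotes the
  preimage of the socle of the quotient.\<close>

lemma The_quotient_Zoc:
  "(THE J. sb_ideal J B \<and> I \<subseteq> J \<and> quot_set B J I = Zoc Q) = {a \<in> carrier B. I #> a \<in> Soc Q}"
    (is "_ = ?J")
proof (rule the_equality)
  have "Soc Q \<subseteq> (\<lambda>a. I #> a) ` carrier B"
    by (auto simp: Soc_def quotient_carrier)
  then have "quot_set B ?J I = Zoc Q"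
    by (auto simp: quot_set_def quotient_Zoc)
  then show J: "sb_ideal ?J B \<and> I \<subseteq> ?J \<and> quot_set B ?J I = Zoc Q"
    using sb_ideal_vimage[OF sb_ideal_Soc_quotient] by blast
  fix K assume "sb_ideal K B \<and> I \<subseteq> K \<and> quot_set B K I = Zoc Q"
  then show "K = ?J"
    using J quot_set_inject[OF ideal] by auto
qed

end

context left_semi_brace
begin

lemma idempotent_ideal_Zoc:
  assumes "sb_ideal (idempotents B) B"
  shows "idempotent_ideal B (Zoc B)"
  using assms sb_ideal_Zoc idempotents_sub_Zoc
  by unfold_locales (auto simp: sb_ideal_def)

lemma idempotent_ideal_Zoc_series:
  assumes E: "sb_ideal (idempotents B) B"
  shows "idempotent_ideal B (Zoc_series B k)"
proof (induction k)
  case 0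
  show ?case using E by unfold_locales auto
next
  case (Suc k)
  show ?case
  proof (cases k)
    case 0
    then show ?thesis using idempotent_ideal_Zoc[OF E] by simp
  next
    case (Suc l)
    interpret I: idempotent_ideal B "Zoc_series B k" by (rule Suc.IH)
    show ?thesis
      using I.sb_ideal_vimage[OF I.sb_ideal_Soc_quotient] I.idempotents_sub_ideal
        I.The_quotient_Zoc
      by unfold_locales (auto simp: Suc)
  qed
qed

lemma Zoc_series_Suc:
  assumes E: "sb_ideal (idempotents B) B" and k: "0 < k"
  shows "Zoc_series B (Suc k) =
    {a \<in> carrier B. Zoc_series B k #> a \<in> Soc (sb_quotient B (Zoc_series B k))}"
proof -
  interpret I: idempotent_ideal B "Zoc_series B k" by (rule idempotent_ideal_Zoc_series[OF E])
  show ?thesis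
    using I.The_quotient_Zoc k by (cases k) auto
qed

lemma Zoc_series_factor:
  assumes E: "sb_ideal (idempotents B) B"
  shows "Zoc_series B k \<subseteq> Zoc_series B (Suc k)"
    and "quot_set B (Zoc_series B (Suc k)) (Zoc_series B k) \<subseteq>
      Soc (sb_quotient B (Zoc_series B k))"
proof -
  interpret I: idempotent_ideal B "Zoc_series B k" by (rule idempotent_ideal_Zoc_series[OF E])
  show "Zoc_series B k \<subseteq> Zoc_series B (Suc k)"
  proof (cases "k = 0")
    case True
    then show ?thesis using idempotents_sub_Zoc by simp
  next
    case False
    then show ?thesis
      using I.sb_ideal_vimage(2)[OF I.sb_ideal_Soc_quotient] Zoc_series_Suc[OF E] by simp
  qed
  have "Zoc_series B k #> a \<in> Soc I.Q" if a: "a \<in> Zoc_series B (Suc k)" for a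
  proof (cases "k = 0")
    case True
    with a obtain s e where se: "s \<in> Soc B" "e \<in> idempotents B" "a = s \<boxplus> e"
      by (auto simp: Zoc_def)
    have s: "s \<in> carrier B" using se(1) by (rule Soc_carrier)
    have "a \<in> carrier B"
      using se s idempotents_sub by auto
    then have "Zoc_series B k #> a = Zoc_series B k #> s"
      using se s I.rcos_eq_iff True by auto
    moreover have "Zoc_series B k #> s \<in> Soc I.Q"
      using se(1) s by (simp add: I.rcos_mem_Soc_iff Soc_iff)
    ultimately show ?thesis by simp
  next
    case False
    then show ?thesis using a Zoc_series_Suc[OF E, of k] by simp
  qed
  then show "quot_set B (Zoc_series B (Suc k)) (Zoc_series B k) \<subseteq> Soc I.Q"
    by (auto simp: quot_set_def)
qed

text \<open>Going up from the bottom term, a \<open>z\<close>-series stays below the generalized socle series with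
  index shifted by one: belonging to the preimage of \<open>Soc (B/I)\<close> means that certain pairs of
  elements are congruent modulo \<open>I\<close>, so this preimage grows with \<open>I\<close>. The shift is needed because
  the preimage of \<open>Soc (B/E)\<close> may exceed \<open>Zoc (B)\<close>.\<close>

lemma z_series_sub_Zoc_series:
  assumes E: "sb_ideal (idempotents B) B" and z: "z_series B I n"
  shows "j \<le> n \<Longrightarrow> I (n - j) \<subseteq> Zoc_series B (Suc j)"
proof (induction j)
  case 0
  then show ?case using z idempotents_sub_Zoc by (simp add: z_series_def)
next
  case (Suc j)
  have step: "I i \<subseteq> I (i - 1) \<and> quot_set B (I (i - 1)) (I i) \<subseteq> Soc (sb_quotient B (I i))"
    if "i \<in> {1..n}" for i
    using z that unfolding z_series_def by blast
  have antimono: "I n \<subseteq> I (n - i)" if "i \<le> n" for i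
    using that
  proof (induction i)
    case (Suc i)
    then have "n - i \<in> {1..n}" "n - Suc i = n - i - 1" by auto
    then have "I (n - i) \<subseteq> I (n - Suc i)" using step[of "n - i"] by simp
    then show ?case using Suc by auto
  qed simp
  let ?A = "I (n - j)" and ?Z = "Zoc_series B (Suc j)"
  have mem: "n - j \<in> {1..n}" "n - Suc j = n - j - 1" using Suc.prems by auto
  interpret A: idempotent_ideal B ?A
    using z antimono[of j] Suc.prems by unfold_locales (auto simp: z_series_def)
  interpret Z: idempotent_ideal B ?Z by (rule idempotent_ideal_Zoc_series[OF E])
  interpret A': normal "I (n - Suc j)" B
    using z by (auto simp: z_series_def sb_ideal_def)
  have AZ: "?A \<subseteq> ?Z" using Suc by simp
  have mono: "?Z #> x = ?Z #> y"
    if "?A #> x = ?A #> y" "x \<in> carrier B" "y \<in> carrier B" for x y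
    using that AZ by (auto simp: A.rcos_eq_iff Z.rcos_eq_iff)
  show ?case
  proof
    fix a assume a: "a \<in> I (n - Suc j)"
    then have aB: "a \<in> carrier B" by auto
    have "quot_set B (I (n - Suc j)) ?A \<subseteq> Soc A.Q"
      using step[OF mem(1)] unfolding mem(2) by blast
    then have "?A #> a \<in> Soc A.Q"
      using a by (auto simp: quot_set_def)
    then have "?Z #> a \<in> Soc Z.Q"
      unfolding A.rcos_mem_Soc_iff[OF aB] Z.rcos_mem_Soc_iff[OF aB]
      using aB by (intro ballI conjI mono) auto
    then show "a \<in> Zoc_series B (Suc (Suc j))"
      unfolding Zoc_series_Suc[OF E zero_less_Suc] using aB by blast
  qed
qed

lemma z_series_Zoc_series:
  assumes E: "sb_ideal (idempotents B) B" and n: "carrier B = Zoc_series B n"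
  shows "z_series B (\<lambda>j. Zoc_series B (n - j)) n"
proof -
  have "Zoc_series B (n - j) \<subseteq> Zoc_series B (n - (j - 1)) \<and>
      quot_set B (Zoc_series B (n - (j - 1))) (Zoc_series B (n - j)) \<subseteq>
        Soc (sb_quotient B (Zoc_series B (n - j)))" if "j \<in> {1..n}" for j
  proof -
    have "n - (j - 1) = Suc (n - j)" using that by auto
    then show ?thesis using Zoc_series_factor[OF E, of "n - j"] by simp
  qed
  moreover have "sb_ideal (Zoc_series B k) B" for k
    using idempotent_ideal.ideal[OF idempotent_ideal_Zoc_series[OF E]] .
  ultimately show ?thesis
    using n by (simp add: z_series_def)
qed

end

theorem proposition37:
  fixes B :: "('a, 'm) semi_brace_scheme"
  assumes "left_semi_brace B"
    and "sb_ideal (idempotents B) B"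
  shows "(\<exists>I n. z_series B I n) \<longleftrightarrow> (\<exists>n>0. carrier B = Zoc_series B n)"
proof -
  interpret left_semi_brace B by (rule assms(1))
  show ?thesis
  proof
    assume "\<exists>I n. z_series B I n"
    then obtain I n where z: "z_series B I n" by blast
    have "I 0 = carrier B" using z by (simp add: z_series_def)
    then have "carrier B \<subseteq> Zoc_series B (Suc n)"
      using z_series_sub_Zoc_series[OF assms(2) z, of n] by simp
    moreover have "Zoc_series B (Suc n) \<subseteq> carrier B"
    proof -
      interpret Z: idempotent_ideal B "Zoc_series B (Suc n)"
        by (rule idempotent_ideal_Zoc_series[OF assms(2)])
      show ?thesis by (rule Z.subset)
    qed
    ultimately show "\<exists>n>0. carrier B = Zoc_series B n" by blast
  next
    assume "\<exists>n>0. carrier B = Zoc_series B n"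
    then show "\<exists>I n. z_series B I n"
      using z_series_Zoc_series[OF assms(2)] by blast
  qed
qed

end
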